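(* Let $X$ be a Banach space and let $(e_i)$ be a semi-normalized Schauder basis for $X$ which is quasi-greedy and democratic (equivalently, almost greedy). Suppose that there exists $K>0$ such that for all $\alpha,\beta\in\operatorname{span}((e_i))$, $$\frac1K\|\alpha\|\,\|\beta\|\le\|\alpha\otimes\beta\|\le K\|\alpha\|\,\|\beta\|.$$ Then $(e_i)$ is equivalent to the unit vector basis of $c_0$ or of $\ell_p$ for some $1\le p<\infty$.
   Context: A sequence $(e_i)$ is semi-normalized if $0<\inf_i\|e_i\|\le\sup_i\|e_i\|<\infty$. $\operatorname{span}((e_i))$ denotes the set of finite linear combinations of the $e_i$. The multiplication $\otimes$ on $\operatorname{span}((e_i))$: for $\alpha=\sum_{i=1}^n a_ie_i$ and $\beta=\sum_{j=1}^m b_je_j$ with $b_m\ne0$, $$\alpha\otimes\beta=\sum_{i=1}^n a_i\Big(\sum_{j=1}^m b_j e_{(i-1)m+j}\Big),$$ and $\alpha\otimes 0=0$. For finite $A\subset\mathbb N$ let $\lambda(A)=\|\sum_{i\in A}e_i\|$, and let $\Phi(n)=\sup\{\lambda(A):|A|\le n\}$. $(e_i)$ is democratic if there is a constant $\Delta$ such that $\Phi(|A|)\le\Delta\lambda(A)$ for all finite $A\subset\mathbb N$. Let $(e_i^* )$ be the biorthogonal functionals of $(e_i)$. For $x\in X$ and $\delta>0$ let $G(x,\delta)=\{i\in\mathbb N:|e_i^*(x)|\ge\delta\}$ and $\mathcal G_\delta(x)=\sum_{i\in G(x,\delta)}e_i^*(x)e_i$. $(e_i)$ is quasi-greedy if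 there exists $A>0$ such that $\|\mathcal G_\delta(x)\|\le A\|x\|$ for all $x\in X$ and all $\delta>0$. It is known that a basis is almost greedy if and only if it is quasi-greedy and democratic; this may be taken as the definition of almost greedy. Two basic sequences $(x_i)$, $(y_i)$ are equivalent if there is $C>0$ with $\frac1C\|\sum a_ix_i\|\le\|\sum a_iy_i\|\le C\|\sum a_ix_i\|$ for all finitely supported scalar sequences $(a_i)$. *)

theory Defs
  imports "HOL-Analysis.Analysis" "HOL-Library.Function_Algebras"
begin

text \<open>
  The scalar field is the type \<open>'k\<close>: the classes \<open>real_normed_field\<close> and
  \<open>euclidean_space\<close> together describe exactly the real and the complex numbers.
  Sequences are indexed from \<open>0\<close>: the entry \<open>e i\<close> stands for the basis vector with number
  \<open>i + 1\<close>.
\<close>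

locale normed_space_over = vector_space smul
  for smul :: "'k::{real_normed_field,euclidean_space} \<Rightarrow> 'a::real_normed_vector \<Rightarrow> 'a" +
  assumes norm_smul: "norm (smul c x) = norm c * norm x"
    and smul_of_real: "smul (of_real r) x = r *\<^sub>R x"

lemma normed_space_over_scaleR: "normed_space_over (scaleR :: real \<Rightarrow> 'a::real_normed_vector \<Rightarrow> 'a)"
  by unfold_locales (auto simp: algebra_simps)

lemma normed_space_over_complex: "normed_space_over ((*) :: complex \<Rightarrow> complex \<Rightarrow> complex)"
  by unfold_locales (auto simp: algebra_simps norm_mult scaleR_conv_of_real)

definition schauder_basis ::
    "('k::{real_normed_field,euclidean_space} \<Rightarrow> 'a::banach \<Rightarrow> 'a) \<Rightarrow> (nat \<Rightarrow> 'a) \<Rightarrow> bool" where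
  "schauder_basis smul e \<longleftrightarrow> (\<forall>x. \<exists>!a. (\<lambda>i. smul (a i) (e i)) sums x)"

definition semi_normalized :: "(nat \<Rightarrow> 'a::real_normed_vector) \<Rightarrow> bool" where
  "semi_normalized e \<longleftrightarrow> 0 < (INF i. norm (e i)) \<and> bdd_above (range (\<lambda>i. norm (e i)))"

text \<open>
  For a Schauder basis \<open>e\<close>, the map \<open>\<lambda>x. coord smul e x i\<close> is the \<open>i\<close>-th biorthogonal functional.
\<close>

definition coord ::
    "('k::{real_normed_field,euclidean_space} \<Rightarrow> 'a::banach \<Rightarrow> 'a) \<Rightarrow> (nat \<Rightarrow> 'a) \<Rightarrow> 'a \<Rightarrow> nat \<Rightarrow> 'k" where
  "coord smul e x = (THE a. (\<lambda>i. smul (a i) (e i)) sums x)"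

definition len ::
    "('k::{real_normed_field,euclidean_space} \<Rightarrow> 'a::banach \<Rightarrow> 'a) \<Rightarrow> (nat \<Rightarrow> 'a) \<Rightarrow> 'a \<Rightarrow> nat" where
  "len smul e x = (LEAST n. \<forall>i\<ge>n. coord smul e x i = 0)"

text \<open>
  The product is only meaningful for \<open>\<alpha>\<close> and \<open>\<beta>\<close> in the span of \<open>e\<close>. Trailing zero coefficients
  of \<open>\<alpha>\<close> do not matter; for \<open>\<beta> \<noteq> 0\<close>, \<open>len smul e \<beta>\<close> is the \<open>m\<close> with last nonzero
  coefficient number \<open>m\<close>. See \<open>otimes_sums\<close> and \<open>otimes_zero_right\<close> below.
\<close>

definition otimes ::
    "('k::{real_normed_field,euclidean_space} \<Rightarrow> 'a::banach \<Rightarrow> 'a) \<Rightarrow> (nat \<Rightarrow> 'a) \<Rightarrow> 'a \<Rightarrow> 'a \<Rightarrow> 'a" where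
  "otimes smul e \<alpha> \<beta> =
    (if \<beta> = 0 then 0
     else \<Sum>i<len smul e \<alpha>. smul (coord smul e \<alpha> i)
       (\<Sum>j<len smul e \<beta>. smul (coord smul e \<beta> j) (e (i * len smul e \<beta> + j))))"

text \<open>The supremum is over a bounded set as soon as the norms of the \<open>e i\<close> are bounded.\<close>

definition fundamental_function :: "(nat \<Rightarrow> 'a::real_normed_vector) \<Rightarrow> nat \<Rightarrow> real" where
  "fundamental_function e n = (SUP A\<in>{A. finite A \<and> card A \<le> n}. norm (\<Sum>i\<in>A. e i))"

definition democratic :: "(nat \<Rightarrow> 'a::real_normed_vector) \<Rightarrow> bool" where
  "democratic e \<longleftrightarrow>
    (\<exists>\<Delta>. \<forall>A. finite A \<longrightarrow> fundamental_function e (card A) \<le> \<Delta> * norm (\<Sum>i\<in>A. e i))"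

definition greedy_set ::
    "('k::{real_normed_field,euclidean_space} \<Rightarrow> 'a::banach \<Rightarrow> 'a) \<Rightarrow> (nat \<Rightarrow> 'a) \<Rightarrow> 'a \<Rightarrow> real \<Rightarrow> nat set" where
  "greedy_set smul e x \<delta> = {i. norm (coord smul e x i) \<ge> \<delta>}"

text \<open>
  The index set of the sum is finite if \<open>e\<close> is a semi-normalized Schauder basis and \<open>\<delta> > 0\<close>;
  see \<open>finite_greedy_set\<close> below.
\<close>

definition greedy_part ::
    "('k::{real_normed_field,euclidean_space} \<Rightarrow> 'a::banach \<Rightarrow> 'a) \<Rightarrow> (nat \<Rightarrow> 'a) \<Rightarrow> real \<Rightarrow> 'a \<Rightarrow> 'a" where
  "greedy_part smul e \<delta> x = (\<Sum>i\<in>greedy_set smul e x \<delta>. smul (coord smul e x i) (e i))"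

definition quasi_greedy ::
    "('k::{real_normed_field,euclidean_space} \<Rightarrow> 'a::banach \<Rightarrow> 'a) \<Rightarrow> (nat \<Rightarrow> 'a) \<Rightarrow> bool" where
  "quasi_greedy smul e \<longleftrightarrow>
    (\<exists>A>0. \<forall>x. \<forall>\<delta>>0. norm (greedy_part smul e \<delta> x) \<le> A * norm x)"

text \<open>
  The two sequences may live in different spaces, each given by a scalar multiplication and a norm.
  Norms are passed explicitly because \<open>c\<^sub>0\<close> and \<open>\<ell>\<^sub>p\<close> are carried by the
  function type \<open>nat \<Rightarrow> 'k\<close> with its pointwise addition; only finite linear combinations occur.
\<close>

definition equivalent_sequences ::
    "('k::zero \<Rightarrow> 'a::comm_monoid_add \<Rightarrow> 'a) \<Rightarrow> ('a \<Rightarrow> real) \<Rightarrow> (nat \<Rightarrow> 'a) \<Rightarrow>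
     ('k \<Rightarrow> 'b::comm_monoid_add \<Rightarrow> 'b) \<Rightarrow> ('b \<Rightarrow> real) \<Rightarrow> (nat \<Rightarrow> 'b) \<Rightarrow> bool" where
  "equivalent_sequences smulX normX x smulY normY y \<longleftrightarrow>
    (\<exists>C>0. \<forall>a. finite {i. a i \<noteq> 0} \<longrightarrow>
      1 / C * normX (\<Sum>i\<in>{i. a i \<noteq> 0}. smulX (a i) (x i))
        \<le> normY (\<Sum>i\<in>{i. a i \<noteq> 0}. smulY (a i) (y i)) \<and>
      normY (\<Sum>i\<in>{i. a i \<noteq> 0}. smulY (a i) (y i))
        \<le> C * normX (\<Sum>i\<in>{i. a i \<noteq> 0}. smulX (a i) (x i)))"

definition seq_smul :: "'k::times \<Rightarrow> (nat \<Rightarrow> 'k) \<Rightarrow> nat \<Rightarrow> 'k" where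
  "seq_smul c f = (\<lambda>i. c * f i)"

definition unit_seq :: "nat \<Rightarrow> nat \<Rightarrow> 'k::zero_neq_one" where
  "unit_seq i = (\<lambda>j. if j = i then 1 else 0)"

definition c0_norm :: "(nat \<Rightarrow> 'k::real_normed_vector) \<Rightarrow> real" where
  "c0_norm f = (SUP i. norm (f i))"

definition lp_norm :: "real \<Rightarrow> (nat \<Rightarrow> 'k::real_normed_vector) \<Rightarrow> real" where
  "lp_norm p f = (\<Sum>i. norm (f i) powr p) powr (1 / p)"

definition equivalent_to_c0 ::
    "('k::{real_normed_field,euclidean_space} \<Rightarrow> 'a::banach \<Rightarrow> 'a) \<Rightarrow> (nat \<Rightarrow> 'a) \<Rightarrow> bool" where
  "equivalent_to_c0 smul e \<longleftrightarrow>
    equivalent_sequences smul norm e seq_smul c0_norm unit_seq"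

definition equivalent_to_lp ::
    "real \<Rightarrow> ('k::{real_normed_field,euclidean_space} \<Rightarrow> 'a::banach \<Rightarrow> 'a) \<Rightarrow> (nat \<Rightarrow> 'a) \<Rightarrow> bool" where
  "equivalent_to_lp p smul e \<longleftrightarrow>
    equivalent_sequences smul norm e seq_smul (lp_norm p) unit_seq"

lemma coord_eqI:
  assumes "schauder_basis smul e" and "(\<lambda>i. smul (a i) (e i)) sums x"
  shows "coord smul e x = a"
  unfolding coord_def using assms by (intro the1_equality) (auto simp: schauder_basis_def)

lemma coord_sums:
  assumes "schauder_basis smul e"
  shows "(\<lambda>i. smul (coord smul e x i) (e i)) sums x"
proof -
  have "\<exists>!a. (\<lambda>i. smul (a i) (e i)) sums x"
    using assms by (simp add: schauder_basis_def)
  from theI'[OF this] show ?thesis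
    unfolding coord_def .
qed

lemma coord_finite_sum:
  assumes "normed_space_over smul" and "schauder_basis smul e"
  shows "coord smul e (\<Sum>i<n. smul (a i) (e i)) = (\<lambda>i. if i < n then a i else 0)"
proof -
  interpret normed_space_over smul by fact
  have "(\<lambda>i. smul (if i < n then a i else 0) (e i)) sums
      (\<Sum>i<n. smul (if i < n then a i else 0) (e i))"
    by (rule sums_finite) auto
  then show ?thesis
    by (intro coord_eqI[OF assms(2)]) simp
qed

lemma finite_greedy_set:
  assumes "normed_space_over smul" and "schauder_basis smul e" and "semi_normalized e" and "\<delta> > 0"
  shows "finite (greedy_set smul e x \<delta>)"
proof -
  interpret normed_space_over smul by fact
  define c where "c = (INF i. norm (e i))"
  have c: "c > 0" "c \<le> norm (e i)" for i
    using assms(3) unfolding semi_normalized_def c_def by (auto intro!: cINF_lower bdd_belowI[of _ 0])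
  have "(\<lambda>i. smul (coord smul e x i) (e i)) \<longlonglongrightarrow> 0"
    using coord_sums[OF assms(2)] by (intro summable_LIMSEQ_zero) (auto simp: sums_iff)
  then have "\<forall>\<^sub>F i in sequentially. norm (smul (coord smul e x i) (e i)) < \<delta> * c"
    by (intro order_tendstoD(2)[OF tendsto_norm_zero]) (use c assms(4) in auto)
  then obtain N where N: "norm (smul (coord smul e x i) (e i)) < \<delta> * c" if "i \<ge> N" for i
    by (auto simp: eventually_sequentially)
  have "i < N" if "i \<in> greedy_set smul e x \<delta>" for i
  proof (rule ccontr)
    assume "\<not> i < N"
    then have "norm (coord smul e x i) * norm (e i) < \<delta> * c"
      using N[of i] by (simp add: norm_smul)
    moreover have "\<delta> * c \<le> norm (coord smul e x i) * norm (e i)"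
      using that c assms(4) by (intro mult_mono) (auto simp: greedy_set_def)
    ultimately show False by simp
  qed
  then show ?thesis
    by (meson finite_nat_set_iff_bounded)
qed

lemma otimes_zero_right: "otimes smul e \<alpha> 0 = 0"
  by (simp add: otimes_def)

lemma otimes_sums:
  assumes "normed_space_over smul" and "schauder_basis smul e" and "m > 0" and "b (m - 1) \<noteq> 0"
  shows "otimes smul e (\<Sum>i<n. smul (a i) (e i)) (\<Sum>j<m. smul (b j) (e j)) =
    (\<Sum>i<n. smul (a i) (\<Sum>j<m. smul (b j) (e (i * m + j))))"
proof -
  interpret normed_space_over smul by fact
  define \<alpha> \<beta> where "\<alpha> = (\<Sum>i<n. smul (a i) (e i))" and "\<beta> = (\<Sum>j<m. smul (b j) (e j))"
  have ca: "coord smul e \<alpha> = (\<lambda>i. if i < n then a i else 0)"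
    and cb: "coord smul e \<beta> = (\<lambda>i. if i < m then b i else 0)"
    unfolding \<alpha>_def \<beta>_def using coord_finite_sum[OF assms(1,2)] by blast+
  have "coord smul e 0 = (\<lambda>i. 0)"
    using coord_finite_sum[OF assms(1,2), where n = 0 and a = "\<lambda>_. 0"] by simp
  moreover have "coord smul e \<beta> (m - 1) \<noteq> 0"
    using cb assms(3,4) by simp
  ultimately have "\<beta> \<noteq> 0"
    by (intro notI) simp
  have lb: "len smul e \<beta> = m"
    unfolding len_def
  proof (rule Least_equality)
    show "\<forall>i\<ge>m. coord smul e \<beta> i = 0" by (simp add: cb)
    show "m \<le> y" if "\<forall>i\<ge>y. coord smul e \<beta> i = 0" for y
    proof (rule ccontr)
      assume "\<not> m \<le> y"
      then have "coord smul e \<beta> (m - 1) = 0" using that by simp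
      then show False using assms(3,4) by (simp add: cb)
    qed
  qed
  have la: "len smul e \<alpha> \<le> n"
    unfolding len_def by (rule Least_le) (simp add: ca)
  have la0: "coord smul e \<alpha> i = 0" if "i \<ge> len smul e \<alpha>" for i
  proof -
    have "\<forall>i\<ge>n. coord smul e \<alpha> i = 0"
      by (simp add: ca)
    then have "\<forall>i\<ge>len smul e \<alpha>. coord smul e \<alpha> i = 0"
      unfolding len_def by (rule LeastI)
    then show ?thesis
      using that by blast
  qed
  have "otimes smul e \<alpha> \<beta> = (\<Sum>i<len smul e \<alpha>. smul (coord smul e \<alpha> i)
      (\<Sum>j<m. smul (b j) (e (i * m + j))))"
    using \<open>\<beta> \<noteq> 0\<close> by (auto simp: otimes_def lb cb intro!: sum.cong arg_cong2[of _ _ _ _ smul])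
  also have "\<dots> = (\<Sum>i<n. smul (coord smul e \<alpha> i) (\<Sum>j<m. smul (b j) (e (i * m + j))))"
    using la la0 by (intro sum.mono_neutral_left) auto
  also have "\<dots> = (\<Sum>i<n. smul (a i) (\<Sum>j<m. smul (b j) (e (i * m + j))))"
    by (intro sum.cong) (simp_all add: ca)
  finally show ?thesis
    by (simp add: \<alpha>_def \<beta>_def)
qed

end

theory Submission
  imports Defs "HOL-Real_Asymp.Real_Asymp"
begin

text \<open>
  Since the indicators of \<open>{..<n}\<close> and \<open>{..<m}\<close> multiply to that of \<open>{..<n * m}\<close>, the fundamental
  function is multiplicative up to a constant, hence comparable to \<open>n powr s\<close> with \<open>0 \<le> s \<le> 1\<close>.
  The \<open>k\<close>-th power of a vector \<open>\<alpha>\<close> of length \<open>N\<close> has at most \<open>(k + 1) ^ N\<close> distinct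
  coefficients, a number polynomial in \<open>k\<close>. Splitting it into its level sets, the triangle
  inequality bounds its norm from above, and quasi-greediness bounds it from below, by
  \<open>\<parallel>\<alpha>\<parallel>\<^sub>p ^ k\<close> with \<open>p = 1 / s\<close> (\<open>p = \<infinity>\<close> if \<open>s = 0\<close>), up to factors polynomial in \<open>k\<close>. Taking \<open>k\<close>-th roots, these
  factors disappear, and \<open>\<alpha>\<close> satisfies the two estimates with constant \<open>K\<close>.
\<close>

section \<open>Functions that are additive up to a constant\<close>

lemma quasi_additive_power:
  fixes f :: "nat \<Rightarrow> real"
  assumes quasi: "\<And>m n. m \<ge> 1 \<Longrightarrow> n \<ge> 1 \<Longrightarrow> \<bar>f (m * n) - f m - f n\<bar> \<le> \<kappa>"
    and "n \<ge> 1" and "k \<ge> 1"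
  shows "\<bar>f (n ^ k) - k * f n\<bar> \<le> k * \<kappa>"
  using \<open>k \<ge> 1\<close>
proof (induction k rule: nat_induct_at_least)
  case base
  then show ?case using quasi[of 1 1] by simp
next
  case (Suc k)
  have "\<bar>f (n * n ^ k) - f n - f (n ^ k)\<bar> \<le> \<kappa>"
    using assms by (intro quasi) auto
  then show ?case using Suc.IH by (simp add: algebra_simps)
qed

text \<open>Otherwise a fraction \<open>j / k\<close> fits strictly between
  \<open>(f n + \<kappa>) / (f m - \<kappa>)\<close> and \<open>ln n / ln m\<close>. Then
  \<open>m ^ j \<le> n ^ k\<close>, and monotonicity combined with the estimate for powers
  contradicts the lower bound on \<open>j / k\<close>.\<close>

lemma quasi_additive_ratio_le:
  fixes f :: "nat \<Rightarrow> real"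
  assumes mono: "\<And>m n. m \<ge> 1 \<Longrightarrow> m \<le> n \<Longrightarrow> f m \<le> f n"
    and quasi: "\<And>m n. m \<ge> 1 \<Longrightarrow> n \<ge> 1 \<Longrightarrow> \<bar>f (m * n) - f m - f n\<bar> \<le> \<kappa>"
    and m: "m \<ge> 2" and n: "n \<ge> 2"
  shows "(f m - \<kappa>) / ln m \<le> (f n + \<kappa>) / ln n"
proof (rule ccontr)
  assume "\<not> ?thesis"
  then have less: "(f n + \<kappa>) / ln n < (f m - \<kappa>) / ln m" by simp
  have lnm: "ln m > 0" and lnn: "ln n > 0" using m n by auto
  have "\<bar>f 1\<bar> \<le> \<kappa>" using quasi[of 1 1] by simp
  moreover have "f 1 \<le> f n" using n by (intro mono) auto
  ultimately have fn: "f n + \<kappa> \<ge> 0" by linarith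
  then have "0 \<le> (f n + \<kappa>) / ln n" using lnn by simp
  then have "0 < (f m - \<kappa>) / ln m" using less by linarith
  then have fm: "f m - \<kappa> > 0" using lnm by (simp add: zero_less_divide_iff)
  have "(f n + \<kappa>) / (f m - \<kappa>) < ln n / ln m"
    using less fm lnm lnn by (simp add: field_simps)
  then obtain q where q: "q \<in> \<rat>" "(f n + \<kappa>) / (f m - \<kappa>) < q" "q < ln n / ln m"
    using Rats_dense_in_real by blast
  have "0 \<le> (f n + \<kappa>) / (f m - \<kappa>)" using fn fm by simp
  then have "q > 0" using q by linarith
  then obtain j k :: nat where jk: "k \<noteq> 0" "q = j / k"
    using q(1) by (metis Rats_abs_nat_div_natE abs_of_pos)
  have "j \<ge> 1" using \<open>q > 0\<close> jk by (cases j) auto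
  have "j * ln m \<le> k * ln n"
    using q(3) jk lnm by (simp add: field_simps)
  then have "ln (real (m ^ j)) \<le> ln (real (n ^ k))"
    using m n by (simp add: ln_realpow)
  then have "real (m ^ j) \<le> real (n ^ k)"
    using m n by (subst (asm) ln_le_cancel_iff) auto
  then have "m ^ j \<le> n ^ k" by linarith
  then have "f (m ^ j) \<le> f (n ^ k)" using m by (intro mono) auto
  moreover have "\<bar>f (m ^ j) - j * f m\<bar> \<le> j * \<kappa>"
    using quasi_additive_power[OF quasi, of m j] m \<open>j \<ge> 1\<close> by auto
  moreover have "\<bar>f (n ^ k) - k * f n\<bar> \<le> k * \<kappa>"
    using quasi_additive_power[OF quasi, of n k] n jk by auto
  ultimately have "j * (f m - \<kappa>) \<le> k * (f n + \<kappa>)" by (simp add: algebra_simps)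
  then have "k * (q * (f m - \<kappa>)) \<le> k * (f n + \<kappa>)" using jk by simp
  then have "q * (f m - \<kappa>) \<le> f n + \<kappa>" using jk by (subst (asm) mult_le_cancel_left_pos) auto
  then have "q \<le> (f n + \<kappa>) / (f m - \<kappa>)"
    using fm by (simp add: pos_le_divide_eq)
  then show False using q by simp
qed

text \<open>The infimum of the upper ratios lies above all lower ratios and serves as the slope
  \<open>s\<close>. The ratios start at 2 because \<open>ln 1 = 0\<close>; at 1 the bound comes from
  \<open>f (1 * 1)\<close>.\<close>

lemma quasi_additive_logarithmic:
  fixes f :: "nat \<Rightarrow> real"
  assumes mono: "\<And>m n. m \<ge> 1 \<Longrightarrow> m \<le> n \<Longrightarrow> f m \<le> f n"
    and quasi: "\<And>m n. m \<ge> 1 \<Longrightarrow> n \<ge> 1 \<Longrightarrow> \<bar>f (m * n) - f m - f n\<bar> \<le> \<kappa>"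
  shows "\<exists>s\<ge>0. \<forall>n\<ge>1. \<bar>f n - s * ln n\<bar> \<le> \<kappa>"
proof -
  define s where "s = (INF n\<in>{2..}. (f n + \<kappa>) / ln (real n))"
  have f1: "\<bar>f 1\<bar> \<le> \<kappa>" using quasi[of 1 1] by simp
  have nonneg: "(f n + \<kappa>) / ln n \<ge> 0" if "n \<ge> 2" for n
  proof -
    have "f 1 \<le> f n" using that by (intro mono) auto
    then show ?thesis using f1 that by (intro divide_nonneg_nonneg) auto
  qed
  have "s \<ge> 0" unfolding s_def by (intro cINF_greatest) (use nonneg in auto)
  have "\<bar>f n - s * ln n\<bar> \<le> \<kappa>" if "n \<ge> 2" for n
  proof -
    have ln: "ln n > 0" using that by auto
    have "s \<le> (f n + \<kappa>) / ln n"
      unfolding s_def using that nonneg by (intro cINF_lower bdd_belowI[of _ 0]) auto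
    moreover have "(f n - \<kappa>) / ln n \<le> s"
      unfolding s_def using quasi_additive_ratio_le[OF mono quasi that] by (intro cINF_greatest) auto
    ultimately show ?thesis using ln by (simp add: field_simps abs_le_iff)
  qed
  moreover have "\<bar>f n - s * ln n\<bar> \<le> \<kappa>" if "n = 1" for n using that f1 by simp
  ultimately have "\<forall>n\<ge>1. \<bar>f n - s * ln n\<bar> \<le> \<kappa>"
    by (metis One_nat_def Suc_1 le_antisym not_less_eq_eq)
  then show ?thesis using \<open>s \<ge> 0\<close> by blast
qed

text \<open>This replaces taking k-th roots: if \<open>x / y\<close> exceeded 1, its powers would
  outgrow every polynomial in \<open>k\<close>.\<close>

lemma le_if_powers_le_polynomial:
  fixes x y :: real
  assumes le: "\<And>k. x ^ k \<le> C * real (k + 1) ^ N * y ^ k" and "y > 0"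
  shows "x \<le> y"
proof (rule ccontr)
  assume "\<not> x \<le> y"
  define r where "r = x / y"
  have "r > 1" using \<open>\<not> x \<le> y\<close> \<open>y > 0\<close> by (simp add: r_def)
  have "r ^ k \<le> C * real (k + 1) ^ N" for k
    using le[of k] \<open>y > 0\<close> by (simp add: r_def power_divide divide_le_eq)
  moreover have "(\<lambda>k. C * real (k + 1) ^ N / r ^ k) \<longlonglongrightarrow> 0"
    using \<open>r > 1\<close> by real_asymp
  then have "\<forall>\<^sub>F k in sequentially. C * real (k + 1) ^ N / r ^ k < 1"
    by (rule order_tendstoD) simp
  then obtain k where "C * real (k + 1) ^ N / r ^ k < 1"
    by (auto simp: eventually_sequentially)
  ultimately show False
    using \<open>r > 1\<close> by (simp add: divide_less_eq) (metis linorder_not_less)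
qed

section \<open>Powers of a finite coefficient sequence\<close>

text \<open>For \<open>i < N ^ k\<close> this is the product of \<open>a\<close> over the
  \<open>k\<close> base-\<open>N\<close> digits of \<open>i\<close>, leading zeros included. The
  value 1 at \<open>k = 0\<close> makes the zeroth power the single vector
  \<open>e 0\<close>.\<close>

primrec tensor_power :: "nat \<Rightarrow> (nat \<Rightarrow> 'k::comm_ring_1) \<Rightarrow> nat \<Rightarrow> nat \<Rightarrow> 'k" where
  "tensor_power N a 0 i = 1"
| "tensor_power N a (Suc k) i = a (i div N ^ k) * tensor_power N a k (i mod N ^ k)"

lemma sum_lessThan_mult:
  fixes f :: "nat \<Rightarrow> 'b::comm_monoid_add"
  shows "(\<Sum>i<n * m. f i) = (\<Sum>i<n. \<Sum>j<m. f (i * m + j))"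
proof -
  have "sum f {i * m..<i * m + m} = (\<Sum>j<m. f (i * m + j))" for i
    using sum.shift_bounds_nat_ivl[of f 0 "i * m" m] by (simp add: atLeast0LessThan add.commute)
  then show ?thesis by (simp add: sum.nat_group[symmetric])
qed

lemma tensor_power_block:
  assumes "j < N ^ k"
  shows "tensor_power N a (Suc k) (i * N ^ k + j) = a i * tensor_power N a k j"
proof -
  have "N ^ k \<noteq> 0" using assms by linarith
  then show ?thesis using assms by (simp add: div_mult_self3 del: power_eq_0_iff)
qed

text \<open>All \<open>k\<close> digits of \<open>N ^ k - 1\<close> are \<open>N - 1\<close>. Hence
  a nonzero last coefficient survives in every power, which fixes the length seen by
  \<open>otimes\<close>.\<close>

lemma tensor_power_last:
  assumes "N > 0"
  shows "tensor_power N a k (N ^ k - 1) = a (N - 1) ^ k"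
proof (induction k)
  case (Suc k)
  have "N ^ Suc k - 1 = (N - 1) * N ^ k + (N ^ k - 1)"
    using assms by (cases N) (auto simp: algebra_simps)
  then show ?case
    using tensor_power_block[of "N ^ k - 1" N k a "N - 1"] Suc assms by (simp del: tensor_power.simps)
qed simp

text \<open>The witness is the index whose \<open>k\<close> digits all equal
  \<open>j\<close>.\<close>

lemma tensor_power_diagonal:
  assumes "j < N"
  shows "\<exists>i<N ^ k. tensor_power N a k i = a j ^ k"
proof (induction k)
  case (Suc k)
  then obtain i where i: "i < N ^ k" "tensor_power N a k i = a j ^ k" by blast
  have "j * N ^ k + i < Suc j * N ^ k" using i by simp
  also have "\<dots> \<le> N ^ Suc k" using assms by (simp del: mult_Suc add: mult_le_mono)
  finally show ?case using tensor_power_block[OF i(1)] i(2) by (metis power_Suc)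
qed simp

text \<open>A sum over all digit strings of length \<open>k\<close> factors into \<open>k\<close>
  sums over one digit.\<close>

lemma sum_norm_tensor_power:
  fixes a :: "nat \<Rightarrow> 'k::real_normed_field"
  shows "(\<Sum>i<N ^ k. norm (tensor_power N a k i) powr p) = (\<Sum>i<N. norm (a i) powr p) ^ k"
proof (induction k)
  case (Suc k)
  have "(\<Sum>i<N ^ Suc k. norm (tensor_power N a (Suc k) i) powr p)
    = (\<Sum>i<N. \<Sum>j<N ^ k. norm (a i) powr p * norm (tensor_power N a k j) powr p)"
    by (simp add: sum_lessThan_mult tensor_power_block norm_mult powr_mult del: tensor_power.simps)
  also have "\<dots> = (\<Sum>i<N. norm (a i) powr p) * (\<Sum>j<N ^ k. norm (tensor_power N a k j) powr p)"
    by (simp add: sum_product)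
  finally show ?case using Suc by simp
qed simp

lemma norm_tensor_power_le:
  fixes a :: "nat \<Rightarrow> 'k::real_normed_field"
  assumes "\<And>i. i < N \<Longrightarrow> norm (a i) \<le> Q" and "i < N ^ k"
  shows "norm (tensor_power N a k i) \<le> Q ^ k"
  using assms(2)
proof (induction k arbitrary: i)
  case (Suc k)
  have "N ^ k > 0" using Suc.prems by (cases "N = 0") auto
  have 1: "i div N ^ k < N" using Suc.prems by (simp add: less_mult_imp_div_less)
  have "norm (tensor_power N a k (i mod N ^ k)) \<le> Q ^ k"
    using \<open>N ^ k > 0\<close> by (intro Suc.IH) simp
  then show ?case
    using assms(1)[OF 1] order_trans[OF norm_ge_zero assms(1)[OF 1]] by (auto simp: norm_mult intro!: mult_mono)
qed simp

text \<open>The exponent \<open>c j\<close> counts the digits of \<open>i\<close> equal to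
  \<open>j\<close>. Its bound by \<open>k\<close> leaves only polynomially many monomials.\<close>

lemma tensor_power_monomial:
  assumes "i < N ^ k"
  shows "\<exists>c. (\<forall>j. c j \<le> k) \<and> tensor_power N a k i = (\<Prod>j<N. a j ^ c j)"
  using assms
proof (induction k arbitrary: i)
  case 0
  show ?case by (intro exI[of _ "\<lambda>_. 0"]) simp
next
  case (Suc k)
  have "N ^ k > 0" using Suc.prems by (cases "N = 0") auto
  then obtain c where c: "\<forall>j. c j \<le> k"
    "tensor_power N a k (i mod N ^ k) = (\<Prod>j<N. a j ^ c j)"
    using Suc.IH[of "i mod N ^ k"] by auto
  define q where "q = i div N ^ k"
  have q: "q < N" using Suc.prems by (simp add: q_def less_mult_imp_div_less)
  have "(\<Prod>j<N. a j ^ (c(q := Suc (c q))) j) = (\<Prod>j<N. (if j = q then a q else 1) * a j ^ c j)"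
    by (intro prod.cong) auto
  also have "\<dots> = a q * (\<Prod>j<N. a j ^ c j)"
    using q by (simp add: prod.distrib)
  finally show ?case
    using c by (intro exI[of _ "c(q := Suc (c q))"]) (auto simp: q_def le_SucI)
qed

lemma card_tensor_power_values:
  "card (tensor_power N a k ` {..<N ^ k}) \<le> (k + 1) ^ N"
proof -
  \<comment> \<open>Extensionality keeps the set of exponent vectors finite, with exactly
    \<open>(k + 1) ^ N\<close> elements.\<close>
  let ?E = "{..<N} \<rightarrow>\<^sub>E {..k}"
  have fin: "finite ?E" by (intro finite_PiE) auto
  have "tensor_power N a k ` {..<N ^ k} \<subseteq> (\<lambda>c. \<Prod>j<N. a j ^ c j) ` ?E"
  proof safe
    fix i assume "i < N ^ k"
    then obtain c where c: "\<forall>j. c j \<le> k" "tensor_power N a k i = (\<Prod>j<N. a j ^ c j)"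
      using tensor_power_monomial by blast
    have "(\<Prod>j<N. a j ^ c j) = (\<Prod>j<N. a j ^ restrict c {..<N} j)" by (intro prod.cong) auto
    then show "tensor_power N a k i \<in> (\<lambda>c. \<Prod>j<N. a j ^ c j) ` ?E"
      using c by (intro image_eqI[of _ _ "restrict c {..<N}"]) auto
  qed
  then have "card (tensor_power N a k ` {..<N ^ k}) \<le> card ?E"
    using fin by (meson card_image_le card_mono finite_imageI le_trans)
  then show ?thesis by (simp add: card_PiE)
qed

section \<open>Multiplicative quasi-greedy democratic bases\<close>

locale multiplicative_basis = normed_space_over smul
  for smul :: "'k::{real_normed_field,euclidean_space} \<Rightarrow> 'a::banach \<Rightarrow> 'a" +
  fixes e :: "nat \<Rightarrow> 'a" and K :: real
  assumes basis: "schauder_basis smul e"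
    and semi_normalized: "semi_normalized e"
    and quasi_greedy: "quasi_greedy smul e"
    and democratic: "democratic e"
    and K_pos: "K > 0"
    and norm_otimes_ge: "\<alpha> \<in> span (range e) \<Longrightarrow> \<beta> \<in> span (range e) \<Longrightarrow>
      1 / K * norm \<alpha> * norm \<beta> \<le> norm (otimes smul e \<alpha> \<beta>)"
    and norm_otimes_le: "\<alpha> \<in> span (range e) \<Longrightarrow> \<beta> \<in> span (range e) \<Longrightarrow>
      norm (otimes smul e \<alpha> \<beta>) \<le> K * norm \<alpha> * norm \<beta>"
begin

section \<open>Finite combinations and the growth of the fundamental function\<close>

abbreviation "comb n a \<equiv> \<Sum>i<n. smul (a i) (e i)"

lemma comb_in_span: "comb n a \<in> span (range e)"
  by (intro span_sum span_scale span_base) auto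

lemma norm_e_pos: "norm (e i) > 0"
proof -
  have "(INF i. norm (e i)) \<le> norm (e i)" by (intro cINF_lower bdd_belowI[of _ 0]) auto
  then show ?thesis using semi_normalized unfolding semi_normalized_def by linarith
qed

text \<open>The linear bound makes the supremum in \<open>fundamental_function\<close> finite and
  later forces the exponent \<open>s\<close> to be at most 1.\<close>

lemma norm_sum_le_card:
  "\<exists>B>0. \<forall>A. finite A \<longrightarrow> norm (\<Sum>i\<in>A. e i) \<le> B * real (card A)"
proof -
  obtain B where B: "norm (e i) \<le> B" for i
    using semi_normalized unfolding semi_normalized_def bdd_above_def by auto
  have "norm (\<Sum>i\<in>A. e i) \<le> B * real (card A)" for A
    using sum_norm_bound[of A e B] B by (simp add: mult.commute)
  moreover have "B > 0" using B[of 0] norm_e_pos[of 0] by linarith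
  ultimately show ?thesis by (intro exI[of _ B]) simp
qed

lemma bdd_above_indicator_norms:
  "bdd_above ((\<lambda>A. norm (\<Sum>i\<in>A. e i)) ` {A. finite A \<and> card A \<le> n})"
proof -
  obtain B where B: "B > 0" "\<And>A. finite A \<Longrightarrow> norm (\<Sum>i\<in>A. e i) \<le> B * real (card A)"
    using norm_sum_le_card by blast
  show ?thesis
  proof (rule bdd_aboveI2)
    fix A :: "nat set" assume "A \<in> {A. finite A \<and> card A \<le> n}"
    then have A: "finite A" "card A \<le> n" by auto
    have "norm (\<Sum>i\<in>A. e i) \<le> B * real (card A)" by (rule B(2)) fact
    also have "\<dots> \<le> B * real n" using A B(1) by (intro mult_left_mono) auto
    finally show "norm (\<Sum>i\<in>A. e i) \<le> B * real n" .
  qed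
qed

lemma norm_le_fundamental_function:
  assumes "finite A" "card A \<le> n"
  shows "norm (\<Sum>i\<in>A. e i) \<le> fundamental_function e n"
  unfolding fundamental_function_def using assms
  by (intro cSUP_upper[OF _ bdd_above_indicator_norms]) simp

lemma fundamental_function_least:
  assumes "\<And>A. finite A \<Longrightarrow> card A \<le> n \<Longrightarrow> norm (\<Sum>i\<in>A. e i) \<le> B"
  shows "fundamental_function e n \<le> B"
  unfolding fundamental_function_def
proof (rule cSUP_least)
  have "{} \<in> {A :: nat set. finite A \<and> card A \<le> n}" by simp
  then show "{A :: nat set. finite A \<and> card A \<le> n} \<noteq> {}" by blast
qed (use assms in simp)

lemma fundamental_function_mono: "m \<le> n \<Longrightarrow> fundamental_function e m \<le> fundamental_function e n"
  by (rule fundamental_function_least) (simp add: norm_le_fundamental_function)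

lemma fundamental_function_le:
  assumes "B \<ge> 0" "\<And>A. finite A \<Longrightarrow> norm (\<Sum>i\<in>A. e i) \<le> B * real (card A)"
  shows "fundamental_function e n \<le> B * real n"
proof (rule fundamental_function_least)
  fix A :: "nat set" assume A: "finite A" "card A \<le> n"
  have "norm (\<Sum>i\<in>A. e i) \<le> B * real (card A)" by (rule assms(2)) fact
  also have "\<dots> \<le> B * real n" using A assms(1) by (intro mult_left_mono) auto
  finally show "norm (\<Sum>i\<in>A. e i) \<le> B * real n" .
qed

lemma fundamental_function_pos: "n \<ge> 1 \<Longrightarrow> fundamental_function e n > 0"
  using norm_le_fundamental_function[of "{0}" n]
    less_le_trans[OF norm_e_pos[of 0], of "fundamental_function e n"] by simp

text \<open>Positivity of the constant is not part of \<open>democratic\<close>; it follows from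
  testing on a singleton.\<close>

lemma democracy_constant:
  "\<exists>\<Delta>>0. \<forall>A. finite A \<longrightarrow> fundamental_function e (card A) \<le> \<Delta> * norm (\<Sum>i\<in>A. e i)"
proof -
  obtain \<Delta> where \<Delta>: "\<And>A. finite A \<Longrightarrow> fundamental_function e (card A) \<le> \<Delta> * norm (\<Sum>i\<in>A. e i)"
    using democratic unfolding democratic_def by blast
  have "\<Delta> * norm (e 0) > 0"
    using \<Delta>[of "{0}"] fundamental_function_pos[of 1] by simp
  then have "\<Delta> > 0" using norm_e_pos[of 0] by (simp add: zero_less_mult_iff)
  then show ?thesis using \<Delta> by blast
qed

text \<open>With all coefficients equal to 1, the blocks of length \<open>m\<close> tile
  \<open>{..<n * m}\<close>.\<close>

lemma otimes_indicator:
  assumes "m \<ge> 1"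
  shows "otimes smul e (\<Sum>i<n. e i) (\<Sum>i<m. e i) = (\<Sum>i<n * m. e i)"
  using otimes_sums[OF normed_space_over_axioms basis, of m "\<lambda>_. 1" "\<lambda>_. 1" n] assms
  by (simp add: sum_lessThan_mult)

text \<open>Democracy replaces the fundamental function by norms of indicators of initial segments,
  to which \<open>otimes_indicator\<close> and the two estimates for \<open>otimes\<close>
  apply.\<close>

lemma fundamental_function_quasi_multiplicative:
  "\<exists>C>0. \<forall>m\<ge>1. \<forall>n\<ge>1.
    fundamental_function e (m * n) \<le> C * (fundamental_function e m * fundamental_function e n) \<and>
    fundamental_function e m * fundamental_function e n \<le> C * fundamental_function e (m * n)"
proof -
  let ?\<phi> = "fundamental_function e" and ?l = "\<lambda>n. norm (\<Sum>i<n. e i)"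
  obtain \<Delta> where \<Delta>: "\<Delta> > 0" "\<And>A. finite A \<Longrightarrow> ?\<phi> (card A) \<le> \<Delta> * norm (\<Sum>i\<in>A. e i)"
    using democracy_constant by blast
  have le: "?l n \<le> ?\<phi> n" and ge: "?\<phi> n \<le> \<Delta> * ?l n" for n
    using norm_le_fundamental_function[of "{..<n}" n] \<Delta>(2)[of "{..<n}"] by auto
  have span: "(\<Sum>i<n. e i) \<in> span (range e)" for n
    using comb_in_span[of "\<lambda>_. 1" n] by simp
  have up: "?\<phi> (m * n) \<le> \<Delta> * K * (?\<phi> m * ?\<phi> n)" if "m \<ge> 1" "n \<ge> 1" for m n
  proof -
    have "?\<phi> (m * n) \<le> \<Delta> * ?l (m * n)" by (rule ge)
    also have "?l (m * n) \<le> K * (?l m * ?l n)"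
      using norm_otimes_le[OF span span, of m n] that by (simp add: otimes_indicator mult.assoc)
    also have "?l m * ?l n \<le> ?\<phi> m * ?\<phi> n"
      using le[of m] le[of n] by (intro mult_mono) (auto intro: order_trans[OF norm_ge_zero])
    finally show ?thesis using \<Delta>(1) K_pos by (simp add: mult.assoc)
  qed
  have lo: "?\<phi> m * ?\<phi> n \<le> \<Delta> * \<Delta> * K * ?\<phi> (m * n)" if "m \<ge> 1" "n \<ge> 1" for m n
  proof -
    have "?\<phi> m * ?\<phi> n \<le> (\<Delta> * ?l m) * (\<Delta> * ?l n)"
      using ge \<Delta>(1) fundamental_function_pos[OF that(2)] by (intro mult_mono) auto
    also have "\<dots> = \<Delta> * \<Delta> * (?l m * ?l n)" by simp
    also have "?l m * ?l n \<le> K * ?l (m * n)"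
      using norm_otimes_ge[OF span span, of m n] that K_pos by (simp add: otimes_indicator field_simps)
    also have "?l (m * n) \<le> ?\<phi> (m * n)" by (rule le)
    finally show ?thesis using \<Delta>(1) K_pos by (simp add: mult.assoc)
  qed
  define C where "C = max (\<Delta> * K) (\<Delta> * \<Delta> * K)"
  show ?thesis
  proof (intro exI[of _ C] conjI allI impI)
    show "C > 0" using \<Delta>(1) K_pos by (simp add: C_def less_max_iff_disj)
    fix m n :: nat assume mn: "m \<ge> 1" "n \<ge> 1"
    have pos: "?\<phi> m > 0" "?\<phi> n > 0" "?\<phi> (m * n) > 0"
      using mn by (auto intro!: fundamental_function_pos)
    have "\<Delta> * K * (?\<phi> m * ?\<phi> n) \<le> C * (?\<phi> m * ?\<phi> n)"
      using pos by (intro mult_right_mono) (auto simp: C_def)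
    then show "?\<phi> (m * n) \<le> C * (?\<phi> m * ?\<phi> n)" using up[OF mn] by linarith
    have "\<Delta> * \<Delta> * K * ?\<phi> (m * n) \<le> C * ?\<phi> (m * n)"
      using pos by (intro mult_right_mono) (auto simp: C_def)
    then show "?\<phi> m * ?\<phi> n \<le> C * ?\<phi> (m * n)" using lo[OF mn] by linarith
  qed
qed

lemma fundamental_function_power_growth:
  "\<exists>s C. 0 \<le> s \<and> s \<le> 1 \<and> C > 0 \<and>
    (\<forall>n\<ge>1. fundamental_function e n \<le> C * n powr s \<and> n powr s \<le> C * fundamental_function e n)"
proof -
  let ?\<phi> = "fundamental_function e"
  obtain C where C: "C > 0"
    "\<And>m n. m \<ge> 1 \<Longrightarrow> n \<ge> 1 \<Longrightarrow> ?\<phi> (m * n) \<le> C * (?\<phi> m * ?\<phi> n)"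
    "\<And>m n. m \<ge> 1 \<Longrightarrow> n \<ge> 1 \<Longrightarrow> ?\<phi> m * ?\<phi> n \<le> C * ?\<phi> (m * n)"
    using fundamental_function_quasi_multiplicative by blast
  \<comment> \<open>Logarithms turn multiplicativity up to the factor \<open>C\<close> into
    additivity up to the error \<open>ln C\<close>.\<close>
  define f where "f n = ln (?\<phi> n)" for n
  have mono: "f m \<le> f n" if "m \<ge> 1" "m \<le> n" for m n
    unfolding f_def using fundamental_function_mono[OF that(2)] fundamental_function_pos that by simp
  have quasi: "\<bar>f (m * n) - f m - f n\<bar> \<le> ln C" if mn: "m \<ge> 1" "n \<ge> 1" for m n
  proof -
    have pos: "?\<phi> m > 0" "?\<phi> n > 0" "?\<phi> (m * n) > 0"
      using mn by (auto intro!: fundamental_function_pos)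
    have "ln (?\<phi> (m * n)) \<le> ln (C * (?\<phi> m * ?\<phi> n))"
      using C(2)[OF mn] pos C(1) by (subst ln_le_cancel_iff) auto
    moreover have "ln (?\<phi> m * ?\<phi> n) \<le> ln (C * ?\<phi> (m * n))"
      using C(3)[OF mn] pos C(1) by (subst ln_le_cancel_iff) auto
    ultimately show ?thesis using pos C(1) by (simp add: f_def ln_mult_pos)
  qed
  obtain s where s: "s \<ge> 0" "\<And>n. n \<ge> 1 \<Longrightarrow> \<bar>f n - s * ln n\<bar> \<le> ln C"
    using quasi_additive_logarithmic[OF mono quasi] by blast
  have exp_f: "exp (f n) = ?\<phi> n" if "n \<ge> 1" for n
    using fundamental_function_pos[OF that] by (simp add: f_def)
  have powr: "exp (s * ln n) = n powr s" if "n \<ge> 1" for n :: nat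
    using that by (simp add: powr_def)
  have up: "?\<phi> n \<le> C * n powr s" if "n \<ge> 1" for n
  proof -
    have "exp (f n) \<le> exp (ln C + s * ln n)" using s(2)[OF that] by (subst exp_le_cancel_iff) linarith
    then show ?thesis using C(1) by (simp add: exp_add exp_f[OF that] powr[OF that])
  qed
  have lo: "n powr s \<le> C * ?\<phi> n" if "n \<ge> 1" for n
  proof -
    have "exp (s * ln n) \<le> exp (ln C + f n)" using s(2)[OF that] by (subst exp_le_cancel_iff) linarith
    then show ?thesis using C(1) by (simp add: exp_add exp_f[OF that] powr[OF that])
  qed
  \<comment> \<open>A larger exponent would outgrow the linear bound given by the triangle
    inequality.\<close>
  have "s \<le> 1"
  proof (rule ccontr)
    assume "\<not> s \<le> 1"
    obtain B where B: "B > 0" "\<And>A. finite A \<Longrightarrow> norm (\<Sum>i\<in>A. e i) \<le> B * real (card A)"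
      using norm_sum_le_card by blast
    have "((\<lambda>n. C * (B * real n) / real n powr s) \<longlongrightarrow> 0) sequentially"
      using \<open>\<not> s \<le> 1\<close> by real_asymp
    then have "\<forall>\<^sub>F n in sequentially. C * (B * real n) / real n powr s < 1"
      by (rule order_tendstoD) simp
    then obtain n where n: "n \<ge> 1" "C * (B * real n) / real n powr s < 1"
      unfolding eventually_sequentially by (metis linear)
    have "n powr s \<le> C * ?\<phi> n" by (rule lo[OF n(1)])
    also have "\<dots> \<le> C * (B * real n)"
      using fundamental_function_le[OF _ B(2), of n] B(1) C(1) by (intro mult_left_mono) auto
    finally have "n powr s \<le> C * (B * real n)" .
    then show False using n by (simp add: divide_less_eq)
  qed
  then show ?thesis using s(1) C(1) up lo by blast
qed

text \<open>Democracy transfers the growth from the supremum to every single set, at the cost of a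
  factor \<open>\<Delta>\<close> in the lower estimate. This is the form applied to level
  sets.\<close>

lemma indicator_norm_power_growth:
  "\<exists>s C. 0 \<le> s \<and> s \<le> 1 \<and> C > 0 \<and> (\<forall>A. finite A \<longrightarrow> A \<noteq> {} \<longrightarrow>
    norm (\<Sum>i\<in>A. e i) \<le> C * card A powr s \<and> card A powr s \<le> C * norm (\<Sum>i\<in>A. e i))"
proof -
  let ?\<phi> = "fundamental_function e"
  obtain s C where sC: "0 \<le> s" "s \<le> 1" "C > 0"
    "\<And>n. n \<ge> 1 \<Longrightarrow> ?\<phi> n \<le> C * n powr s" "\<And>n. n \<ge> 1 \<Longrightarrow> n powr s \<le> C * ?\<phi> n"
    using fundamental_function_power_growth by blast
  obtain \<Delta> where \<Delta>: "\<Delta> > 0" "\<And>A. finite A \<Longrightarrow> ?\<phi> (card A) \<le> \<Delta> * norm (\<Sum>i\<in>A. e i)"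
    using democracy_constant by blast
  have 1: "norm (\<Sum>i\<in>A. e i) \<le> max C (C * \<Delta>) * card A powr s"
    and 2: "card A powr s \<le> max C (C * \<Delta>) * norm (\<Sum>i\<in>A. e i)" if A: "finite A" "A \<noteq> {}" for A
  proof -
    have n: "card A \<ge> 1" using A by (simp add: Suc_leI card_gt_0_iff)
    have "norm (\<Sum>i\<in>A. e i) \<le> C * card A powr s"
      using norm_le_fundamental_function[OF A(1), of "card A"] sC(4)[OF n] by simp
    also have "\<dots> \<le> max C (C * \<Delta>) * card A powr s" by (intro mult_right_mono) auto
    finally show "norm (\<Sum>i\<in>A. e i) \<le> max C (C * \<Delta>) * card A powr s" .
    have "card A powr s \<le> C * ?\<phi> (card A)" by (rule sC(5)[OF n])
    also have "\<dots> \<le> C * (\<Delta> * norm (\<Sum>i\<in>A. e i))"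
      using \<Delta>(2)[OF A(1)] sC(3) by (intro mult_left_mono) auto
    also have "\<dots> \<le> max C (C * \<Delta>) * norm (\<Sum>i\<in>A. e i)"
      by (subst mult.assoc[symmetric], intro mult_right_mono) auto
    finally show "card A powr s \<le> max C (C * \<Delta>) * norm (\<Sum>i\<in>A. e i)" .
  qed
  show ?thesis
    by (intro exI[of _ s] exI[of _ "max C (C * \<Delta>)"] conjI allI impI 1 2)
      (use sC in \<open>auto simp: less_max_iff_disj\<close>)
qed

section \<open>Greedy parts and level sets\<close>

lemma greedy_part_comb:
  assumes "\<delta> > 0"
  shows "greedy_part smul e \<delta> (comb n a) = (\<Sum>i | i < n \<and> norm (a i) \<ge> \<delta>. smul (a i) (e i))"
proof -
  have c: "coord smul e (comb n a) = (\<lambda>i. if i < n then a i else 0)"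
    by (rule coord_finite_sum[OF normed_space_over_axioms basis])
  \<comment> \<open>The zero coefficients from \<open>n\<close> on stay out because
    \<open>\<delta>\<close> is positive.\<close>
  have "greedy_set smul e (comb n a) \<delta> = {i. i < n \<and> norm (a i) \<ge> \<delta>}"
    using assms by (auto simp: greedy_set_def c)
  then show ?thesis by (simp add: greedy_part_def c)
qed

text \<open>
  Shrinking the coefficients equal to \<open>v\<close> by a factor \<open>1 - \<eta>\<close> removes exactly these from the greedy
  part at level \<open>norm v\<close>, so the level set is a difference of two greedy parts.
\<close>

lemma norm_level_set_le:
  "\<exists>C>0. \<forall>n a v. v \<noteq> 0 \<longrightarrow> norm v * norm (\<Sum>i | i < n \<and> a i = v. e i) \<le> C * norm (comb n a)"
proof -
  obtain A where A: "A > 0" "\<And>x \<delta>. \<delta> > 0 \<Longrightarrow> norm (greedy_part smul e \<delta> x) \<le> A * norm x"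
    using quasi_greedy unfolding quasi_greedy_def by blast
  \<comment> \<open>This choice gives \<open>A * \<eta> \<le> 1 / 2\<close>, which allows the term
    in \<open>norm z\<close> to be absorbed; the summand 1 keeps \<open>\<eta>\<close> below 1 when
    \<open>A\<close> is small.\<close>
  define \<eta> where "\<eta> = 1 / (2 * (A + 1))"
  have \<eta>: "0 < \<eta>" "\<eta> < 1" "A * \<eta> \<le> 1 / 2" using A(1) by (auto simp: \<eta>_def field_simps)
  have "norm v * norm (\<Sum>i | i < n \<and> a i = v. e i) \<le> 4 * A * norm (comb n a)" if "v \<noteq> 0" for n a v
  proof -
    define b where "b i = (if a i = v then of_real (1 - \<eta>) * v else a i)" for i
    define z where "z = (\<Sum>i | i < n \<and> a i = v. smul (a i) (e i))"
    have z: "z = smul v (\<Sum>i | i < n \<and> a i = v. e i)"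
      unfolding z_def scale_sum_right by (intro sum.cong) auto
    have pos: "norm v > 0" using that by simp
    have "norm (of_real (1 - \<eta>) * v) < norm v"
      using \<eta> pos by (simp add: norm_mult del: of_real_diff)
    then have set: "{i. i < n \<and> norm (b i) \<ge> norm v} = {i. i < n \<and> norm (a i) \<ge> norm v} - {i. i < n \<and> a i = v}"
      by (auto simp: b_def)
    have "greedy_part smul e (norm v) (comb n b)
        = (\<Sum>i\<in>{i. i < n \<and> norm (a i) \<ge> norm v} - {i. i < n \<and> a i = v}. smul (a i) (e i))"
      unfolding greedy_part_comb[OF pos] set by (intro sum.cong) (auto simp: b_def)
    also have "\<dots> = greedy_part smul e (norm v) (comb n a) - z"
      unfolding greedy_part_comb[OF pos] z_def by (intro sum_diff) auto
    finally have "z = greedy_part smul e (norm v) (comb n a) - greedy_part smul e (norm v) (comb n b)"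
      by simp
    then have "norm z \<le> norm (greedy_part smul e (norm v) (comb n a)) + norm (greedy_part smul e (norm v) (comb n b))"
      by (metis norm_triangle_ineq4)
    also have "\<dots> \<le> A * norm (comb n a) + A * norm (comb n b)"
      using A(2)[OF pos] by (intro add_mono) auto
    also have "norm (comb n b) \<le> norm (comb n a) + \<eta> * norm z"
    proof -
      have "z = (\<Sum>i<n. if a i = v then smul (a i) (e i) else 0)"
        unfolding z_def by (simp add: sum.inter_filter[symmetric])
      then have "comb n a - smul (of_real \<eta>) z
          = (\<Sum>i<n. smul (a i) (e i) - smul (of_real \<eta>) (if a i = v then smul (a i) (e i) else 0))"
        by (simp add: scale_sum_right sum_subtractf)
      also have "\<dots> = comb n b"
        by (intro sum.cong) (auto simp: b_def scale_left_diff_distrib left_diff_distrib)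
      finally have "norm (comb n b) \<le> norm (comb n a) + norm (smul (of_real \<eta>) z)"
        by (metis norm_triangle_ineq4)
      then show ?thesis using \<eta> by (simp add: norm_smul)
    qed
    finally have "norm z \<le> A * norm (comb n a) + A * (norm (comb n a) + \<eta> * norm z)"
      using A(1) by simp
    \<comment> \<open>Moving half of \<open>norm z\<close> to the left doubles \<open>2 * A\<close>,
      whence the constant \<open>4 * A\<close>.\<close>
    moreover have "A * \<eta> * norm z \<le> 1 / 2 * norm z" using \<eta>(3) by (intro mult_right_mono) auto
    ultimately have "norm z \<le> 4 * A * norm (comb n a)" by (simp add: algebra_simps)
    then show ?thesis by (simp add: z norm_smul)
  qed
  then show ?thesis using A(1) by (intro exI[of _ "4 * A"]) auto
qed

section \<open>Powers of a vector and their norms\<close>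

abbreviation "power_comb N a k \<equiv> comb (N ^ k) (tensor_power N a k)"

text \<open>The new factor stands on the left because \<open>otimes\<close> uses blocks as long as
  its right factor. That length is \<open>N ^ k\<close>, so the block number becomes the leading
  digit.\<close>

lemma power_comb_Suc:
  assumes "N > 0" "a (N - 1) \<noteq> 0"
  shows "power_comb N a (Suc k) = otimes smul e (comb N a) (power_comb N a k)"
proof -
  have "otimes smul e (comb N a) (power_comb N a k)
    = (\<Sum>i<N. smul (a i) (\<Sum>j<N ^ k. smul (tensor_power N a k j) (e (i * N ^ k + j))))"
    using assms tensor_power_last[of N a k]
    by (intro otimes_sums[OF normed_space_over_axioms basis]) (simp_all del: One_nat_def)
  also have "\<dots> = (\<Sum>i<N. \<Sum>j<N ^ k. smul (tensor_power N a (Suc k) (i * N ^ k + j)) (e (i * N ^ k + j)))"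
    by (simp add: scale_sum_right tensor_power_block del: tensor_power.simps)
  also have "\<dots> = power_comb N a (Suc k)"
    by (simp add: sum_lessThan_mult del: tensor_power.simps)
  finally show ?thesis by simp
qed

text \<open>Each factor costs at most one \<open>K\<close>, starting from \<open>e 0\<close>. The
  total \<open>K ^ k\<close> shrinks to a single \<open>K\<close> once k-th roots are taken.\<close>

lemma norm_power_comb:
  assumes "N > 0" "a (N - 1) \<noteq> 0"
  shows "norm (power_comb N a k) \<le> (K * norm (comb N a)) ^ k * norm (e 0)"
    and "(norm (comb N a) / K) ^ k * norm (e 0) \<le> norm (power_comb N a k)"
proof (induction k)
  case 0
  { case 1 then show ?case by simp next case 2 then show ?case by simp }
next
  case (Suc k)
  { case 1
    have "norm (power_comb N a (Suc k)) \<le> K * norm (comb N a) * norm (power_comb N a k)"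
      unfolding power_comb_Suc[of N a k, OF assms] by (intro norm_otimes_le comb_in_span)
    also have "\<dots> \<le> K * norm (comb N a) * ((K * norm (comb N a)) ^ k * norm (e 0))"
      using Suc(1) K_pos by (intro mult_left_mono) auto
    finally show ?case by (simp add: mult.assoc)
  next
    case 2
    have "norm (comb N a) / K * ((norm (comb N a) / K) ^ k * norm (e 0)) \<le> norm (comb N a) / K * norm (power_comb N a k)"
      using Suc(2) K_pos by (intro mult_left_mono) auto
    also have "\<dots> \<le> norm (power_comb N a (Suc k))"
      unfolding power_comb_Suc[of N a k, OF assms] using norm_otimes_ge[OF comb_in_span comb_in_span] by simp
    finally show ?case by (simp add: mult.assoc)
  }
qed

text \<open>
  The number \<open>Q\<close> stands for the norm of \<open>a\<close> in \<open>\<ell>\<^sub>p\<close> with \<open>p = 1 / s\<close>, or in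
  \<open>c\<^sub>0\<close> if \<open>s = 0\<close>.
\<close>

lemma norm_comb_comparable:
  assumes C: "C > 0"
    and growth: "\<forall>A. finite A \<longrightarrow> A \<noteq> {} \<longrightarrow>
      norm (\<Sum>i\<in>A. e i) \<le> C * card A powr s \<and> card A powr s \<le> C * norm (\<Sum>i\<in>A. e i)"
    and a: "N > 0" "a (N - 1) \<noteq> 0" and Q: "Q > 0"
    and upper: "\<And>k i. i < N ^ k \<Longrightarrow> norm (tensor_power N a k i) *
      card {j. j < N ^ k \<and> tensor_power N a k j = tensor_power N a k i} powr s \<le> Q ^ k"
    and lower: "\<And>k. \<exists>i<N ^ k. Q ^ k \<le> real (k + 1) ^ N * (norm (tensor_power N a k i) *
      card {j. j < N ^ k \<and> tensor_power N a k j = tensor_power N a k i} powr s)"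
  shows "norm (comb N a) \<le> K * Q" and "Q \<le> K * norm (comb N a)"
proof -
  define L where "L k v = {j. j < N ^ k \<and> tensor_power N a k j = v}" for k v
  have e0: "norm (e 0) > 0" by (rule norm_e_pos)
  have "(norm (comb N a) / K) ^ k \<le> C / norm (e 0) * real (k + 1) ^ N * Q ^ k" for k
  proof -
    let ?V = "tensor_power N a k ` {..<N ^ k}"
    \<comment> \<open>Grouping equal coefficients leaves at most \<open>(k + 1) ^ N\<close> terms,
      each a scalar times the indicator of a level set.\<close>
    have "power_comb N a k = (\<Sum>v\<in>?V. \<Sum>j | j \<in> {..<N ^ k} \<and> tensor_power N a k j = v. smul (tensor_power N a k j) (e j))"
      by (rule sum.image_gen) simp
    also have "\<dots> = (\<Sum>v\<in>?V. smul v (\<Sum>j\<in>L k v. e j))"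
      by (intro sum.cong refl) (auto simp: L_def scale_sum_right intro!: sum.cong)
    also have "norm \<dots> \<le> (\<Sum>v\<in>?V. C * Q ^ k)"
    proof (rule sum_norm_le)
      fix v assume "v \<in> ?V"
      then obtain i where i: "i < N ^ k" "v = tensor_power N a k i" by blast
      have "norm (\<Sum>j\<in>L k v. e j) \<le> C * card (L k v) powr s"
        using i growth[rule_format, of "L k v"] by (auto simp: L_def)
      then have "norm v * norm (\<Sum>j\<in>L k v. e j) \<le> norm v * (C * card (L k v) powr s)"
        by (intro mult_left_mono) auto
      also have "\<dots> = C * (norm v * card (L k v) powr s)" by simp
      also have "\<dots> \<le> C * Q ^ k" using upper[OF i(1)] C i(2) by (simp add: L_def)
      finally show "norm (smul v (\<Sum>j\<in>L k v. e j)) \<le> C * Q ^ k" by (simp add: norm_smul)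
    qed
    also have "\<dots> = real (card ?V) * (C * Q ^ k)" by simp
    also have "\<dots> \<le> real ((k + 1) ^ N) * (C * Q ^ k)"
      using C Q by (intro mult_right_mono) (simp_all only: of_nat_le_iff card_tensor_power_values, simp)
    finally have "(norm (comb N a) / K) ^ k * norm (e 0) \<le> real (k + 1) ^ N * (C * Q ^ k)"
      using norm_power_comb(2)[of N a k, OF a] by simp
    then show ?thesis using e0 by (simp add: field_simps)
  qed
  then have "norm (comb N a) / K \<le> Q" using Q by (rule le_if_powers_le_polynomial)
  then show "norm (comb N a) \<le> K * Q" using K_pos by (simp add: field_simps)

  obtain D where D: "D > 0"
    "\<And>n b v. v \<noteq> 0 \<Longrightarrow> norm v * norm (\<Sum>i | i < n \<and> b i = v. e i) \<le> D * norm (comb n b)"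
    using norm_level_set_le by blast
  have le: "Q ^ k \<le> C * D * norm (e 0) * real (k + 1) ^ N * (K * norm (comb N a)) ^ k" for k
  proof -
    \<comment> \<open>One level set carries \<open>Q ^ k\<close> up to a polynomial factor, and
      \<open>norm_level_set_le\<close> bounds it by the norm of the whole power.\<close>
    obtain i where i: "i < N ^ k" and Qi: "Q ^ k \<le> real (k + 1) ^ N *
        (norm (tensor_power N a k i) * card (L k (tensor_power N a k i)) powr s)"
      using lower[of k] by (auto simp: L_def)
    define v where "v = tensor_power N a k i"
    have "v \<noteq> 0"
    proof
      assume "v = 0"
      then have "Q ^ k \<le> 0" using Qi by (simp add: v_def)
      then show False using zero_less_power[OF Q, of k] by linarith
    qed
    have "norm v * card (L k v) powr s \<le> norm v * (C * norm (\<Sum>j\<in>L k v. e j))"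
      using i growth[rule_format, of "L k v"] by (intro mult_left_mono) (auto simp: L_def v_def)
    also have "\<dots> = C * (norm v * norm (\<Sum>j\<in>L k v. e j))" by simp
    also have "\<dots> \<le> C * (D * norm (power_comb N a k))"
      using D(2)[OF \<open>v \<noteq> 0\<close>, of "N ^ k" "tensor_power N a k"] C by (simp add: L_def)
    also have "\<dots> \<le> C * (D * ((K * norm (comb N a)) ^ k * norm (e 0)))"
      using norm_power_comb(1)[of N a k, OF a] C D(1) by simp
    finally have "real (k + 1) ^ N * (norm v * card (L k v) powr s)
        \<le> real (k + 1) ^ N * (C * (D * ((K * norm (comb N a)) ^ k * norm (e 0))))"
      by (intro mult_left_mono) auto
    from order_trans[OF Qi[folded v_def] this] show ?thesis by (simp add: mult_ac)
  qed
  \<comment> \<open>The root argument needs a positive right-hand base; the estimate for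
    \<open>k = 1\<close> rules out zero.\<close>
  have "comb N a \<noteq> 0"
  proof
    assume "comb N a = 0"
    then have "Q ^ 1 \<le> 0" using le[of 1] by (simp only: norm_zero) simp
    then show False using Q by simp
  qed
  then have "K * norm (comb N a) > 0" using K_pos by simp
  with le show "Q \<le> K * norm (comb N a)" by (rule le_if_powers_le_polynomial)
qed

section \<open>Comparison with the unit vector bases\<close>

text \<open>A nonzero finitely supported sequence can be cut right after its last nonzero entry,
  which is the form required for taking powers. The equivalence constant is \<open>K\<close>
  itself.\<close>

lemma equivalent_sequencesI:
  fixes normY :: "(nat \<Rightarrow> 'k) \<Rightarrow> real"
  assumes zero: "normY (\<lambda>_. 0) = 0"
    and comparable: "\<And>N a. N > 0 \<Longrightarrow> a (N - 1) \<noteq> 0 \<Longrightarrow> (\<And>i. i \<ge> N \<Longrightarrow> a i = 0) \<Longrightarrow>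
      norm (comb N a) \<le> K * normY a \<and> normY a \<le> K * norm (comb N a)"
  shows "equivalent_sequences smul norm e seq_smul normY unit_seq"
  unfolding equivalent_sequences_def
proof (intro exI[of _ K] conjI[OF K_pos] allI impI)
  fix a :: "nat \<Rightarrow> 'k" assume fin: "finite {i. a i \<noteq> 0}"
  let ?S = "{i. a i \<noteq> 0}"
  have sum_apply: "(\<Sum>i\<in>?S. f i) j = (\<Sum>i\<in>?S. f i j)" for f :: "nat \<Rightarrow> nat \<Rightarrow> 'k" and j
    using fin by (induction rule: finite_induct) auto
  have a: "(\<Sum>i\<in>?S. seq_smul (a i) (unit_seq i)) = a"
  proof
    fix j
    have "(\<Sum>i\<in>?S. seq_smul (a i) (unit_seq i)) j = (\<Sum>i\<in>?S. if i = j then a j else 0)"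
      unfolding sum_apply by (intro sum.cong) (auto simp: seq_smul_def unit_seq_def)
    then show "(\<Sum>i\<in>?S. seq_smul (a i) (unit_seq i)) j = a j"
      using fin by simp
  qed
  have "norm (\<Sum>i\<in>?S. smul (a i) (e i)) \<le> K * normY a \<and> normY a \<le> K * norm (\<Sum>i\<in>?S. smul (a i) (e i))"
  proof (cases "?S = {}")
    case True
    then have "a = (\<lambda>_. 0)" by auto
    then show ?thesis using zero by simp
  next
    case False
    define N where "N = Suc (Max ?S)"
    have last: "a (N - 1) \<noteq> 0" using Max_in[OF fin False] by (simp add: N_def)
    have out: "a i = 0" if "i \<ge> N" for i
      using Max_ge[OF fin, of i] that by (auto simp: N_def)
    have "(\<Sum>i\<in>?S. smul (a i) (e i)) = comb N a"
      using out by (intro sum.mono_neutral_left) (auto simp: not_le[symmetric])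
    moreover have "norm (comb N a) \<le> K * normY a \<and> normY a \<le> K * norm (comb N a)"
      using last out by (intro comparable) (auto simp: N_def)
    ultimately show ?thesis by (simp only:)
  qed
  then show "1 / K * norm (\<Sum>i\<in>?S. smul (a i) (e i)) \<le> normY (\<Sum>i\<in>?S. seq_smul (a i) (unit_seq i)) \<and>
    normY (\<Sum>i\<in>?S. seq_smul (a i) (unit_seq i)) \<le> K * norm (\<Sum>i\<in>?S. smul (a i) (e i))"
    unfolding a using K_pos by (simp add: pos_divide_le_eq mult.commute)
qed

theorem equivalent_to_c0_or_lp: "equivalent_to_c0 smul e \<or> (\<exists>p\<ge>1. equivalent_to_lp p smul e)"
proof -
  obtain s C where s: "0 \<le> s" "s \<le> 1" and C: "C > 0"
    "\<forall>A. finite A \<longrightarrow> A \<noteq> {} \<longrightarrow>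
      norm (\<Sum>i\<in>A. e i) \<le> C * card A powr s \<and> card A powr s \<le> C * norm (\<Sum>i\<in>A. e i)"
    using indicator_norm_power_growth by blast
  show ?thesis
  proof (cases "s = 0")
    case True
    have "equivalent_to_c0 smul e"
      unfolding equivalent_to_c0_def
    proof (rule equivalent_sequencesI)
      show "c0_norm (\<lambda>_::nat. 0::'k) = 0" by (simp add: c0_norm_def)
      fix N and a :: "nat \<Rightarrow> 'k"
      assume a: "N > 0" "a (N - 1) \<noteq> 0" and out: "\<And>i. i \<ge> N \<Longrightarrow> a i = 0"
      have "a i \<in> insert 0 (a ` {..<N})" for i
        using out[of i] by (cases "i < N") auto
      \<comment> \<open>With finitely many values, the supremum in \<open>c0_norm\<close> is
        attained.\<close>
      then have "finite (range a)"
        by (intro finite_subset[of "range a" "insert 0 (a ` {..<N})"]) auto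
      then have fin: "finite (range (\<lambda>i. norm (a i)))"
        by (metis finite_imageI image_image)
      define Q where "Q = c0_norm a"
      have Q: "Q = Max (range (\<lambda>i. norm (a i)))"
        unfolding Q_def c0_norm_def using fin by (intro cSup_eq_Max) auto
      have le: "norm (a i) \<le> Q" for i unfolding Q using fin by (intro Max_ge) auto
      have "Q > 0" using le[of "N - 1"] a(2) by (metis less_le_trans zero_less_norm_iff)
      have "Q \<in> range (\<lambda>i. norm (a i))" unfolding Q using fin by (intro Max_in) auto
      then obtain j where j: "Q = norm (a j)" by blast
      then have "j < N" using out \<open>Q > 0\<close> by (metis less_irrefl linorder_not_le norm_zero)
      \<comment> \<open>The level set contains \<open>i\<close>, so its cardinality is positive;
        this matters because \<open>0 powr 0\<close> is 0.\<close>
      have card_pos: "card {j. j < N ^ k \<and> tensor_power N a k j = tensor_power N a k i} powr s = 1"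
        if "i < N ^ k" for i k
        using that True by auto
      note comparable = norm_comb_comparable[of C s N a Q, OF C a \<open>Q > 0\<close>]
      have upper: "norm (tensor_power N a k i) *
          card {j. j < N ^ k \<and> tensor_power N a k j = tensor_power N a k i} powr s \<le> Q ^ k"
        if "i < N ^ k" for k i
        using norm_tensor_power_le[OF le that] card_pos[OF that] by simp
      have lower: "\<exists>i<N ^ k. Q ^ k \<le> real (k + 1) ^ N * (norm (tensor_power N a k i) *
          card {j. j < N ^ k \<and> tensor_power N a k j = tensor_power N a k i} powr s)" for k
      proof -
        \<comment> \<open>A coefficient of maximal norm, repeated in all \<open>k\<close> digits,
          gives a coefficient of norm \<open>Q ^ k\<close>.\<close>
        obtain i where i: "i < N ^ k" "tensor_power N a k i = a j ^ k"
          using tensor_power_diagonal[OF \<open>j < N\<close>] by blast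
        have "1 * Q ^ k \<le> real (k + 1) ^ N * Q ^ k"
          using \<open>Q > 0\<close> by (intro mult_right_mono one_le_power) auto
        then show ?thesis using i card_pos[OF i(1)] j by (intro exI[of _ i]) (simp add: norm_power)
      qed
      show "norm (comb N a) \<le> K * c0_norm a \<and> c0_norm a \<le> K * norm (comb N a)"
        using comparable[OF upper lower] by (simp add: Q_def)
    qed
    then show ?thesis ..
  next
    case False
    then have "s > 0" using s by simp
    \<comment> \<open>The bound \<open>s \<le> 1\<close> is what gives
      \<open>p \<ge> 1\<close>.\<close>
    define p where "p = 1 / s"
    have p: "p \<ge> 1" "p * s = 1" using s \<open>s > 0\<close> by (auto simp: p_def)
    have "equivalent_to_lp p smul e"
      unfolding equivalent_to_lp_def
    proof (rule equivalent_sequencesI)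
      show "lp_norm p (\<lambda>_::nat. 0::'k) = 0" by (simp add: lp_norm_def)
      fix N and a :: "nat \<Rightarrow> 'k"
      assume a: "N > 0" "a (N - 1) \<noteq> 0" and out: "\<And>i. i \<ge> N \<Longrightarrow> a i = 0"
      define S where "S = (\<Sum>i<N. norm (a i) powr p)"
      have "norm (a (N - 1)) powr p \<le> S"
        unfolding S_def using a by (intro member_le_sum) auto
      moreover have "norm (a (N - 1)) powr p > 0" using a by simp
      ultimately have "S > 0" by linarith
      define Q where "Q = S powr s"
      have "(\<Sum>i. norm (a i) powr p) = S"
        unfolding S_def using out by (intro suminf_finite) auto
      then have lp: "lp_norm p a = Q" by (simp add: lp_norm_def Q_def p_def)
      have "Q > 0" using \<open>S > 0\<close> by (simp add: Q_def)
      have Qk: "Q ^ k = (S ^ k) powr s" for k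
        using \<open>S > 0\<close> by (simp add: Q_def powr_realpow[symmetric] powr_powr mult.commute)
      define L where "L k v = {j. j < N ^ k \<and> tensor_power N a k j = v}" for k v
      \<comment> \<open>Since \<open>p * s = 1\<close>, the power \<open>s\<close> turns the share
        of a level set in the sum of p-th powers into the quantity of
        \<open>norm_comb_comparable\<close>.\<close>
      have root: "(norm v powr p * card (L k v)) powr s = norm v * card (L k v) powr s" for k v
        using p by (simp add: powr_mult powr_powr)
      have level: "norm v powr p * card (L k v) = (\<Sum>j | j \<in> {..<N ^ k} \<and> tensor_power N a k j = v.
          norm (tensor_power N a k j) powr p)" for k v
        by (simp add: L_def)
      note comparable = norm_comb_comparable[of C s N a Q, OF C a \<open>Q > 0\<close>]
      have upper: "norm (tensor_power N a k i) *
          card {j. j < N ^ k \<and> tensor_power N a k j = tensor_power N a k i} powr s \<le> Q ^ k"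
        if "i < N ^ k" for k i
      proof -
        have "norm (tensor_power N a k i) powr p * card (L k (tensor_power N a k i))
            \<le> (\<Sum>j<N ^ k. norm (tensor_power N a k j) powr p)"
          unfolding level by (intro sum_mono2) auto
        then have "(norm (tensor_power N a k i) powr p * card (L k (tensor_power N a k i))) powr s \<le> Q ^ k"
          unfolding Qk sum_norm_tensor_power S_def[symmetric] using s by (intro powr_mono2) auto
        then show ?thesis unfolding root by (simp add: L_def)
      qed
      have lower: "\<exists>i<N ^ k. Q ^ k \<le> real (k + 1) ^ N * (norm (tensor_power N a k i) *
          card {j. j < N ^ k \<and> tensor_power N a k j = tensor_power N a k i} powr s)" for k
      proof -
        let ?V = "tensor_power N a k ` {..<N ^ k}"
        \<comment> \<open>By pigeonhole, the largest of at most \<open>(k + 1) ^ N\<close> shares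
          \<open>g v\<close> of \<open>S ^ k\<close> is at least
          \<open>S ^ k / (k + 1) ^ N\<close>.\<close>
        define g where "g v = norm v powr p * card (L k v)" for v
        have ne: "?V \<noteq> {}" using a by (auto simp: lessThan_empty_iff)
        then have "Max (g ` ?V) \<in> g ` ?V" by (intro Max_in) auto
        then obtain i where i: "i < N ^ k" "Max (g ` ?V) = g (tensor_power N a k i)" by auto
        define v where "v = tensor_power N a k i"
        have max: "g w \<le> g v" if "w \<in> ?V" for w
          unfolding v_def i(2)[symmetric] using that by (intro Max_ge) auto
        have "S ^ k = (\<Sum>w\<in>?V. g w)"
          unfolding S_def sum_norm_tensor_power[symmetric] g_def level by (rule sum.image_gen) simp
        also have "\<dots> \<le> real (card ?V) * g v"
          using max by (rule sum_bounded_above)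
        also have "\<dots> \<le> real ((k + 1) ^ N) * g v"
          by (intro mult_right_mono) (simp_all only: of_nat_le_iff card_tensor_power_values, simp add: g_def)
        finally have "(S ^ k) powr s \<le> (real ((k + 1) ^ N) * g v) powr s"
          using s \<open>S > 0\<close> by (intro powr_mono2) auto
        also have "\<dots> = real ((k + 1) ^ N) powr s * (norm v * card (L k v) powr s)"
          by (simp add: powr_mult g_def root[symmetric])
        \<comment> \<open>Because \<open>s \<le> 1\<close> and the base is at least 1, raising the
          exponent to 1 gives the polynomial factor its required form.\<close>
        also have "\<dots> \<le> real ((k + 1) ^ N) powr 1 * (norm v * card (L k v) powr s)"
          using s by (intro mult_right_mono powr_mono) auto
        finally show ?thesis
          using i(1) unfolding Qk by (intro exI[of _ i]) (simp add: v_def L_def)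
      qed
      show "norm (comb N a) \<le> K * lp_norm p a \<and> lp_norm p a \<le> K * norm (comb N a)"
        using comparable[OF upper lower] by (simp add: lp)
    qed
    then show ?thesis using p by blast
  qed
qed

end

theorem theorem12:
  fixes smul :: "'k::{real_normed_field,euclidean_space} \<Rightarrow> 'a::banach \<Rightarrow> 'a"
    and e :: "nat \<Rightarrow> 'a"
  assumes "normed_space_over smul"
    and "schauder_basis smul e"
    and "semi_normalized e"
    and "quasi_greedy smul e"
    and "democratic e"
    and "\<exists>K>0. \<forall>\<alpha>\<in>module.span smul (range e). \<forall>\<beta>\<in>module.span smul (range e).
      1 / K * norm \<alpha> * norm \<beta> \<le> norm (otimes smul e \<alpha> \<beta>) \<and>
      norm (otimes smul e \<alpha> \<beta>) \<le> K * norm \<alpha> * norm \<beta>"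
  shows "equivalent_to_c0 smul e \<or> (\<exists>p\<ge>1. equivalent_to_lp p smul e)"
proof -
  obtain K where "K > 0" and K: "\<forall>\<alpha>\<in>module.span smul (range e). \<forall>\<beta>\<in>module.span smul (range e).
      1 / K * norm \<alpha> * norm \<beta> \<le> norm (otimes smul e \<alpha> \<beta>) \<and>
      norm (otimes smul e \<alpha> \<beta>) \<le> K * norm \<alpha> * norm \<beta>"
    using assms(6) by blast
  interpret normed_space_over smul by fact
  interpret multiplicative_basis smul e K
    by unfold_locales (use assms \<open>K > 0\<close> K in blast)+
  show ?thesis by (rule equivalent_to_c0_or_lp)
qed

end
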